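(* Let $G(L)=(V,E,L)$ be a temporal graph or temporal digraph and $s\in V$. The time complexity of the Foremost Journey Algorithm (described in the context) on input $(G(L),s)$ is $O\big(c(L)\cdot\log c(L)\big)$, where $c(L)=\sum_{e\in E}|L_e|$.
   Context: A temporal (di)graph is a triple $G(L)=(V,E,L)$ where $(V,E)$ is a finite (di)graph and $L=\{L_e\subseteq\mathbb{N}^*: e\in E\}$ assigns to each edge (arc) a (finite) set of positive integer labels. The cost of $L$ is $c(L)=\sum_{e\in E}|L_e|$. A time edge is a triple $(u,v,l)$ where $e=\{u,v\}$ (resp. $e=(u,v)$) is an edge (resp. arc) and $l\in L_e$; an undirected edge $\{u,v\}$ yields both $(u,v,l)$ and $(v,u,l)$ for every $l\in L_e$. $S(L)$ denotes the set of all time edges (arcs). Foremost Journey Algorithm (input: $G(L)$, $s$): 1. Sort $S(L)$ in increasing order of labels (by a comparison-based sort); let $S'$ be the sorted array. 2. Set $R:=\{s\}$, $arrival\_time[s]:=0$, and for all $v\in V\setminus\{s\}$ set $parent[v]:=\emptyset$, $arrival\_time[v]:=+\infty$. 3. For all time edges (arcs) $(a,b,l)$ in the order given by $S'$: if $a\in R$ and $b\notin R$ and $arrival\_time[a]<l$, then set $parent[b]:=a$, $arrival\_time[b]:=l$, $R:=R\cup\{b\}$.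
   Formalization: Step 2 is not run as a loop over V, which would cost |V| and break the bound with many isolated vertices; the vertex arrays are virtually initialised in constant time, with every access charged. S(L) is given as a list, and the sort is merge sort. *)

theory Defs
  imports
    Complex_Main
    "HOL-Library.Multiset"
    "HOL-Library.Extended_Nat"
    "HOL-Library.Landau_Symbols"
    "HOL-Library.Monad_Syntax"
begin

section \<open>Temporal graphs and digraphs\<close>

text \<open>
  An undirected edge is the set \<open>{u, v}\<close> and an arc is the pair \<open>(u, v)\<close>. Loops are permitted,
  edges with an empty label set too.
\<close>

datatype 'v temporal_graph =
    TGraph "'v set" "'v set set" "'v set \<Rightarrow> nat set"
  | TDigraph "'v set" "('v \<times> 'v) set" "'v \<times> 'v \<Rightarrow> nat set"

fun vertices :: "'v temporal_graph \<Rightarrow> 'v set" where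
  "vertices (TGraph V E L) = V"
| "vertices (TDigraph V A L) = V"

fun wf_temporal_graph :: "'v temporal_graph \<Rightarrow> bool" where
  "wf_temporal_graph (TGraph V E L) \<longleftrightarrow>
     finite V \<and> E \<subseteq> {{u, v} | u v. u \<in> V \<and> v \<in> V} \<and> (\<forall>e\<in>E. finite (L e) \<and> 0 \<notin> L e)"
| "wf_temporal_graph (TDigraph V A L) \<longleftrightarrow>
     finite V \<and> A \<subseteq> V \<times> V \<and> (\<forall>e\<in>A. finite (L e) \<and> 0 \<notin> L e)"

fun labeling_cost :: "'v temporal_graph \<Rightarrow> nat" where
  "labeling_cost (TGraph V E L) = (\<Sum>e\<in>E. card (L e))"
| "labeling_cost (TDigraph V A L) = (\<Sum>e\<in>A. card (L e))"

type_synonym 'v time_edge = "'v \<times> 'v \<times> nat"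

fun time_edges :: "'v temporal_graph \<Rightarrow> 'v time_edge set" where
  "time_edges (TGraph V E L) = {(u, v, l). {u, v} \<in> E \<and> l \<in> L {u, v}}"
| "time_edges (TDigraph V A L) = {(u, v, l). (u, v) \<in> A \<and> l \<in> L (u, v)}"

abbreviation label :: "'v time_edge \<Rightarrow> nat" where
  "label e \<equiv> snd (snd e)"


section \<open>Step-counting programs\<close>

text \<open>
  Uniform-cost model: a program returns a value together with the number of elementary steps
  performed. A \<open>step\<close> is one elementary operation (arithmetic, comparison, list construction, read
  or write of one memory cell); a \<open>tick\<close> pays for a function call together with the case
  distinction on its arguments. Functions on indices model memory and are used single-threadedly.
\<close>

type_synonym 'a timed = "'a \<times> nat"

definition result :: "'a timed \<Rightarrow> 'a" where
  "result = fst"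

definition run_time :: "'a timed \<Rightarrow> nat" where
  "run_time = snd"

definition return_timed :: "'a \<Rightarrow> 'a timed" where
  "return_timed x = (x, 0)"

definition step :: "'a \<Rightarrow> 'a timed" where
  "step x = (x, 1)"

definition tick :: "unit timed" where
  "tick = step ()"

definition bind_timed :: "'a timed \<Rightarrow> ('a \<Rightarrow> 'b timed) \<Rightarrow> 'b timed" where
  "bind_timed m f = (result (f (result m)), run_time m + run_time (f (result m)))"

adhoc_overloading Monad_Syntax.bind \<rightleftharpoons> bind_timed

lemma result_simps [simp]:
  "result (return_timed x) = x" "result (step x) = x" "result tick = ()"
  "result (bind_timed m f) = result (f (result m))"
  by (simp_all add: result_def return_timed_def step_def tick_def bind_timed_def)

lemma run_time_simps [simp]:
  "run_time (return_timed x) = 0" "run_time (step x) = 1" "run_time tick = 1"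
  "run_time (bind_timed m f) = run_time m + run_time (f (result m))"
  by (simp_all add: run_time_def return_timed_def step_def tick_def bind_timed_def)


section \<open>Arrays with a default value\<close>

text \<open>
  Filling an array over \<open>V\<close> cell by cell costs \<open>|V|\<close> steps, and \<open>|V|\<close> is not bounded by any
  function of the number of time edges. The instruction ``for all vertices, set the cell to
  the default value'' is therefore realised by the classical array with virtual initialisation:
  the memory \<open>data\<close>, \<open>pos\<close>, \<open>stack\<close> is allocated with arbitrary contents, \<open>stack\<close> lists in its
  first \<open>filled\<close> cells the indices written so far, and the cell of \<open>v\<close> counts as written iff \<open>pos v\<close>
  points to such an occurrence of \<open>v\<close>. Reading and writing then take a constant number
  of memory accesses.
\<close>

type_synonym ('v, 'a) raw_memory = "('v \<Rightarrow> 'a) \<times> ('v \<Rightarrow> nat) \<times> (nat \<Rightarrow> 'v)"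

record ('v, 'a) array =
  data :: "'v \<Rightarrow> 'a"
  pos :: "'v \<Rightarrow> nat"
  stack :: "nat \<Rightarrow> 'v"
  filled :: nat
  default_value :: 'a

fun new_array :: "('v, 'a) raw_memory \<Rightarrow> 'a \<Rightarrow> ('v, 'a) array timed" where
  "new_array (d, p, st) x = do {
     n \<leftarrow> step 0;
     y \<leftarrow> step x;
     return_timed \<lparr>data = d, pos = p, stack = st, filled = n, default_value = y\<rparr>
   }"

definition is_written :: "('v, 'a) array \<Rightarrow> 'v \<Rightarrow> bool timed" where
  "is_written A v = do {
     i \<leftarrow> step (pos A v);
     b \<leftarrow> step (i < filled A);
     if b then do {
       w \<leftarrow> step (stack A i);
       step (w = v)
     } else return_timed False
   }"

definition read_array :: "('v, 'a) array \<Rightarrow> 'v \<Rightarrow> 'a timed" where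
  "read_array A v = do {
     tick;
     b \<leftarrow> is_written A v;
     if b then step (data A v) else step (default_value A)
   }"

definition write_array :: "('v, 'a) array \<Rightarrow> 'v \<Rightarrow> 'a \<Rightarrow> ('v, 'a) array timed" where
  "write_array A v x = do {
     tick;
     b \<leftarrow> is_written A v;
     A \<leftarrow> (if b then return_timed A else do {
        A \<leftarrow> step (A\<lparr>pos := (pos A)(v := filled A)\<rparr>);
        A \<leftarrow> step (A\<lparr>stack := (stack A)(filled A := v)\<rparr>);
        step (A\<lparr>filled := filled A + 1\<rparr>)
      });
     step (A\<lparr>data := (data A)(v := x)\<rparr>)
   }"

definition contents :: "('v, 'a) array \<Rightarrow> 'v \<Rightarrow> 'a" where
  "contents A v = result (read_array A v)"

lemma contents_new_array [simp]: "contents (result (new_array m x)) = (\<lambda>_. x)"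
  by (cases m) (auto simp: contents_def read_array_def is_written_def fun_eq_iff)

declare new_array.simps [simp del]

lemma contents_write_array [simp]: "contents (result (write_array A v x)) = (contents A)(v := x)"
  by (auto simp: contents_def read_array_def write_array_def is_written_def fun_eq_iff)


section \<open>Sorting by labels\<close>

text \<open>Merge sort: labels are inspected through comparisons only.\<close>

fun merge :: "'v time_edge list \<Rightarrow> 'v time_edge list \<Rightarrow> 'v time_edge list timed" where
  "merge [] ys = do { tick; return_timed ys }"
| "merge xs [] = do { tick; return_timed xs }"
| "merge (x # xs) (y # ys) = do {
     tick;
     b \<leftarrow> step (label x \<le> label y);
     if b then do { zs \<leftarrow> merge xs (y # ys); step (x # zs) }
     else do { zs \<leftarrow> merge (x # xs) ys; step (y # zs) }
   }"

text \<open>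
  \<open>sort_prefix n xs\<close> returns the sorted list of the first \<open>n\<close> elements of \<open>xs\<close>, and the remaining
  elements.
\<close>

fun sort_prefix ::
  "nat \<Rightarrow> 'v time_edge list \<Rightarrow> ('v time_edge list \<times> 'v time_edge list) timed" where
  "sort_prefix n xs =
     (if n = 0 then do { tick; return_timed ([], xs) }
      else if n = 1 then do { tick; step ([hd xs], tl xs) }
      else do {
        tick;
        h \<leftarrow> step (n div 2);
        k \<leftarrow> step (n - n div 2);
        (ys, xs') \<leftarrow> sort_prefix (n div 2) xs;
        (zs, xs'') \<leftarrow> sort_prefix (n - n div 2) xs';
        s \<leftarrow> merge ys zs;
        return_timed (s, xs'')
      })"

declare sort_prefix.simps [simp del]

fun list_length :: "'a list \<Rightarrow> nat timed" where
  "list_length [] = do { tick; return_timed 0 }"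
| "list_length (x # xs) = do { tick; n \<leftarrow> list_length xs; step (n + 1) }"

definition sort_labels :: "'v time_edge list \<Rightarrow> 'v time_edge list timed" where
  "sort_labels xs = do {
     n \<leftarrow> list_length xs;
     (ys, zs) \<leftarrow> sort_prefix n xs;
     return_timed ys
   }"

lemma mset_merge [simp]: "mset (result (merge xs ys)) = mset xs + mset ys"
  by (induction xs ys rule: merge.induct) auto

lemma set_merge [simp]: "set (result (merge xs ys)) = set xs \<union> set ys"
  by (metis mset_merge set_mset_mset set_mset_union)

lemma sorted_merge:
  "sorted (map label xs) \<Longrightarrow> sorted (map label ys) \<Longrightarrow> sorted (map label (result (merge xs ys)))"
  by (induction xs ys rule: merge.induct) (force simp del: set_append)+

lemma sort_prefix_correct:
  "n \<le> length xs \<Longrightarrow>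
   \<exists>ys. result (sort_prefix n xs) = (ys, drop n xs) \<and> mset ys = mset (take n xs) \<and>
        sorted (map label ys)"
proof (induction n arbitrary: xs rule: less_induct)
  case (less n)
  show ?case
  proof (cases "n \<le> 1")
    case True
    then consider "n = 0" | "n = 1" "xs \<noteq> []" using less.prems by force
    then show ?thesis
    proof cases
      case 1
      then show ?thesis by (simp add: sort_prefix.simps)
    next
      case 2
      then show ?thesis by (cases xs) (simp_all add: sort_prefix.simps)
    qed
  next
    case False
    let ?h = "n div 2" let ?k = "n - n div 2"
    have h: "?h < n" "?h \<le> length xs"
      using less.prems False by linarith+
    obtain ys where ys: "result (sort_prefix ?h xs) = (ys, drop ?h xs)"
        "mset ys = mset (take ?h xs)" "sorted (map label ys)"
      using less.IH[OF h] by blast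
    have "?k \<le> length (drop ?h xs)" "?k < n"
      using less.prems False by auto
    then obtain zs where zs: "result (sort_prefix ?k (drop ?h xs)) = (zs, drop ?k (drop ?h xs))"
        "mset zs = mset (take ?k (drop ?h xs))" "sorted (map label zs)"
      using less.IH[of ?k "drop ?h xs"] by auto
    have "take n xs = take ?h xs @ take ?k (drop ?h xs)"
      by (metis div_le_dividend le_add_diff_inverse take_add)
    moreover have "drop ?k (drop ?h xs) = drop n xs" by simp
    ultimately show ?thesis
      using False ys zs by (subst sort_prefix.simps) (simp add: sorted_merge)
  qed
qed

lemma result_list_length [simp]: "result (list_length xs) = length xs"
  by (induction xs) auto

lemma sort_labels_correct:
  "mset (result (sort_labels xs)) = mset xs" "sorted (map label (result (sort_labels xs)))"
  using sort_prefix_correct[of "length xs" xs] by (auto simp: sort_labels_def)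


section \<open>The Foremost Journey Algorithm\<close>

text \<open>
  The membership array of \<open>R\<close>, the array \<open>parent\<close> (with \<open>None\<close> for the value written as the empty
  set) and the array \<open>arrival_time\<close>.
\<close>

type_synonym 'v state = "('v, bool) array \<times> ('v, 'v option) array \<times> ('v, enat) array"

type_synonym 'v state_memory =
  "('v, bool) raw_memory \<times> ('v, 'v option) raw_memory \<times> ('v, enat) raw_memory"

fun initialise :: "'v \<Rightarrow> 'v state_memory \<Rightarrow> 'v state timed" where
  "initialise s (mR, mp, mt) = do {
     R \<leftarrow> new_array mR False;
     R \<leftarrow> write_array R s True;
     arrival \<leftarrow> new_array mt \<infinity>;
     arrival \<leftarrow> write_array arrival s 0;
     parent \<leftarrow> new_array mp None;
     return_timed (R, parent, arrival)
   }"

fun process :: "'v time_edge \<Rightarrow> 'v state \<Rightarrow> 'v state timed" where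
  "process (a, b, l) (R, parent, arrival) = do {
     tick;
     a_in \<leftarrow> read_array R a;
     b_in \<leftarrow> read_array R b;
     t \<leftarrow> read_array arrival a;
     c \<leftarrow> step (t < enat l);
     if a_in \<and> \<not> b_in \<and> c then do {
       parent \<leftarrow> write_array parent b (Some a);
       arrival \<leftarrow> write_array arrival b (enat l);
       R \<leftarrow> write_array R b True;
       return_timed (R, parent, arrival)
     } else return_timed (R, parent, arrival)
   }"

fun process_all :: "'v time_edge list \<Rightarrow> 'v state \<Rightarrow> 'v state timed" where
  "process_all [] \<sigma> = do { tick; return_timed \<sigma> }"
| "process_all (e # es) \<sigma> = do { tick; \<sigma> \<leftarrow> process e \<sigma>; process_all es \<sigma> }"

text \<open>
  The argument \<open>xs\<close> is the unsorted array holding the time edges, \<open>m\<close> the memory in which the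
  arrays over the vertices are allocated.
\<close>

definition foremost_journey :: "'v time_edge list \<Rightarrow> 'v \<Rightarrow> 'v state_memory \<Rightarrow> 'v state timed" where
  "foremost_journey xs s m = do {
     xs' \<leftarrow> sort_labels xs;
     \<sigma> \<leftarrow> initialise s m;
     process_all xs' \<sigma>
   }"

text \<open>
  The result is that of the loop on mathematical sets and functions, whatever the initial memory
  contents.
\<close>

fun relax :: "'v set \<times> ('v \<Rightarrow> 'v option) \<times> ('v \<Rightarrow> enat) \<Rightarrow> 'v time_edge
    \<Rightarrow> 'v set \<times> ('v \<Rightarrow> 'v option) \<times> ('v \<Rightarrow> enat)" where
  "relax (R, parent, arrival) (a, b, l) =
     (if a \<in> R \<and> b \<notin> R \<and> arrival a < enat l
      then (insert b R, parent(b := Some a), arrival(b := enat l))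
      else (R, parent, arrival))"

fun state_contents :: "'v state \<Rightarrow> 'v set \<times> ('v \<Rightarrow> 'v option) \<times> ('v \<Rightarrow> enat)" where
  "state_contents (R, parent, arrival) = ({v. contents R v}, contents parent, contents arrival)"

lemma state_contents_process:
  "state_contents (result (process e \<sigma>)) = relax (state_contents \<sigma>) e"
  by (cases e; cases \<sigma>) (auto simp flip: contents_def)

lemma state_contents_process_all:
  "state_contents (result (process_all es \<sigma>)) = foldl relax (state_contents \<sigma>) es"
  by (induction es arbitrary: \<sigma>) (simp_all add: state_contents_process)

lemma state_contents_initialise:
  "state_contents (result (initialise s m)) = ({s}, \<lambda>_. None, (\<lambda>_. \<infinity>)(s := 0))"
  by (cases m) (auto split: if_splits)

theorem foremost_journey_correct:
  "\<exists>xs'. mset xs' = mset xs \<and> sorted (map label xs') \<and>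
     state_contents (result (foremost_journey xs s m)) =
       foldl relax ({s}, \<lambda>_. None, (\<lambda>_. \<infinity>)(s := 0)) xs'"
  by (rule exI[of _ "result (sort_labels xs)"])
     (simp add: foremost_journey_def sort_labels_correct state_contents_process_all
        state_contents_initialise)


section \<open>Inputs\<close>

text \<open>
  An input consists of a temporal (di)graph, an enumeration of its time edges in arbitrary order,
  a source and arbitrary initial memory contents.
\<close>

type_synonym 'v input = "'v temporal_graph \<times> 'v time_edge list \<times> 'v \<times> 'v state_memory"

definition inputs :: "'v input set" where
  "inputs = {(G, xs, s, m). wf_temporal_graph G \<and> distinct xs \<and> set xs = time_edges G \<and> s \<in> vertices G}"

fun input_cost :: "'v input \<Rightarrow> nat" where
  "input_cost (G, xs, s, m) = labeling_cost G"

fun algorithm_time :: "'v input \<Rightarrow> nat" where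
  "algorithm_time (G, xs, s, m) = run_time (foremost_journey xs s m)"

text \<open>
  Asymptotics for \<open>c(L) \<longrightarrow> \<infinity>\<close>, uniformly in all the inputs: an eventual property holds for every
  input whose cost is large enough.
\<close>

definition large_cost :: "'v input filter" where
  "large_cost = inf (filtercomap input_cost at_top) (principal inputs)"

lemma eventually_large_cost:
  "eventually P large_cost \<longleftrightarrow> (\<exists>N. \<forall>I\<in>inputs. input_cost I \<ge> N \<longrightarrow> P I)"
  unfolding large_cost_def eventually_inf_principal eventually_filtercomap_at_top_linorder
  by blast

end

theory Submission
  imports Defs
begin

text \<open>
  Let \<open>n\<close> be the number of time edges. Merge sort takes \<open>O(n log n)\<close> steps, and with virtually
  initialised arrays everything else takes \<open>O(n)\<close>, independently of the number of vertices. Each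
  label of an edge yields at most two time edges, so \<open>n \<le> 2 c(L)\<close>.
\<close>

text \<open>The factor 2 comes from the undirected case alone: time edges are grouped by their
  underlying edge, and each label is read in both orientations. Arcs give an image of
  \<open>Sigma A L\<close>, hence factor 1.\<close>

lemma card_time_edges_le:
  assumes "wf_temporal_graph G"
  shows "card (time_edges G) \<le> 2 * labeling_cost G"
proof (cases G)
  case (TGraph V E L)
  let ?T = "\<lambda>e. {(u, v, l). {u, v} = e \<and> l \<in> L e}"
  have V: "finite V" and E: "E \<subseteq> {{u, v} |u v. u \<in> V \<and> v \<in> V}"
    and L: "\<And>e. e \<in> E \<Longrightarrow> finite (L e)"
    using assms TGraph by auto
  have "E \<subseteq> Pow V" using E by auto
  then have "finite E" using V by (simp add: finite_subset)
  have T: "card (?T e) \<le> 2 * card (L e)" if e_in: "e \<in> E" for e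
  proof -
    obtain a b where e: "e = {a, b}" using E e_in by blast
    let ?F = "\<lambda>u v. (\<lambda>l. (u, v, l)) ` L e"
    \<comment> \<open>One image per orientation; for a loop the two coincide, which the inclusion
      allows.\<close>
    have "?T e \<subseteq> ?F a b \<union> ?F b a" unfolding e by (auto simp: doubleton_eq_iff)
    then have "card (?T e) \<le> card (?F a b \<union> ?F b a)"
      using L[OF e_in] by (intro card_mono) auto
    also have "\<dots> \<le> card (?F a b) + card (?F b a)" by (rule card_Un_le)
    also have "\<dots> \<le> 2 * card (L e)"
      using card_image_le[OF L[OF e_in]] by (smt (verit) add_mono mult_2)
    finally show ?thesis .
  qed
  have "time_edges G = (\<Union>e\<in>E. ?T e)" unfolding TGraph by auto
  then have "card (time_edges G) \<le> (\<Sum>e\<in>E. card (?T e))"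
    by (simp only: card_UN_le[OF \<open>finite E\<close>])
  also have "\<dots> \<le> (\<Sum>e\<in>E. 2 * card (L e))" by (intro sum_mono T)
  finally show ?thesis unfolding TGraph by (simp add: sum_distrib_left)
next
  case (TDigraph V A L)
  have "finite A" and L: "\<forall>e\<in>A. finite (L e)"
    using assms TDigraph by (auto intro: finite_subset)
  let ?f = "\<lambda>(e, l). (fst e, snd e, l)"
  have "time_edges G \<subseteq> ?f ` Sigma A L"
    unfolding TDigraph by (auto intro!: rev_image_eqI)
  moreover have "finite (Sigma A L)" using \<open>finite A\<close> L by simp
  ultimately have "card (time_edges G) \<le> card (Sigma A L)"
    by (rule surj_card_le[rotated])
  then show ?thesis
    using card_SigmaI[OF \<open>finite A\<close> L] unfolding TDigraph by simp
qed

text \<open>Each recursive call pays a tick, a comparison and a list construction, and consumes one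
  element; the final call adds one tick.\<close>

lemma run_time_merge: "run_time (merge xs ys) \<le> 3 * (length xs + length ys) + 1"
  by (induction xs ys rule: merge.induct) auto

lemma run_time_list_length: "run_time (list_length xs) = 2 * length xs + 1"
  by (induction xs) auto

text \<open>
  The summand \<open>4\<close> on the left makes the induction work: it is gained once from each of the two
  recursive calls and pays for the constant overhead of the merge step.
\<close>

lemma run_time_sort_prefix:
  "0 < n \<Longrightarrow> n \<le> 2 ^ d \<Longrightarrow> n \<le> length xs \<Longrightarrow>
   run_time (sort_prefix n xs) + 4 \<le> (3 * d + 6) * n"
proof (induction d arbitrary: n xs)
  case 0
  \<comment> \<open>The constant 6 is fixed here: a singleton costs 2 steps, plus the summand
    4.\<close>
  then have "n = 1" by simp
  then show ?case by (simp add: sort_prefix.simps)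
next
  case (Suc d)
  show ?case
  proof (cases "n = 1")
    case True
    then show ?thesis by (simp add: sort_prefix.simps)
  next
    case False
    let ?h = "n div 2" let ?k = "n - n div 2"
    have h: "0 < ?h" "?h \<le> 2 ^ d" "?h \<le> length xs"
      and k: "0 < ?k" "?k \<le> 2 ^ d" "?k \<le> length (drop ?h xs)"
      using Suc.prems False by auto
    obtain ys where ys: "result (sort_prefix ?h xs) = (ys, drop ?h xs)"
        "mset ys = mset (take ?h xs)"
      using sort_prefix_correct[OF h(3)] by blast
    obtain zs where zs: "result (sort_prefix ?k (drop ?h xs)) = (zs, drop ?k (drop ?h xs))"
        "mset zs = mset (take ?k (drop ?h xs))"
      using sort_prefix_correct[OF k(3)] by blast
    have "length ys + length zs = n"
      using mset_eq_length[OF ys(2)] mset_eq_length[OF zs(2)] h k by simp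
    then have "run_time (merge ys zs) \<le> 3 * n + 1"
      using run_time_merge[of ys zs] by simp
    moreover have "run_time (sort_prefix n xs) =
        3 + run_time (sort_prefix ?h xs) + run_time (sort_prefix ?k (drop ?h xs)) +
        run_time (merge ys zs)"
      using False Suc.prems(1) ys zs by (subst sort_prefix.simps) simp
    \<comment> \<open>One more level of recursion enlarges the bound by \<open>3 * n\<close>, the
      linear part of the merge cost.\<close>
    moreover have "(3 * Suc d + 6) * n = (3 * d + 6) * ?h + (3 * d + 6) * ?k + 3 * n"
    proof -
      have "(3 * Suc d + 6) * n = (3 * d + 6) * n + 3 * n" by (simp add: algebra_simps)
      moreover have "(3 * d + 6) * n = (3 * d + 6) * ?h + (3 * d + 6) * ?k"
        by (metis distrib_left div_le_dividend le_add_diff_inverse)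
      ultimately show ?thesis by (simp only:)
    qed
    ultimately show ?thesis
      using Suc.IH[OF h] Suc.IH[OF k] by linarith
  qed
qed

lemma run_time_sort_labels:
  assumes "length xs \<le> 2 ^ d"
  shows "run_time (sort_labels xs) \<le> (3 * d + 8) * length xs + 2"
proof -
  \<comment> \<open>The \<open>+ 1\<close> covers the empty list, which costs a single tick.\<close>
  have "run_time (sort_prefix (length xs) xs) \<le> (3 * d + 6) * length xs + 1"
  proof (cases "xs = []")
    case True
    then show ?thesis by (simp add: sort_prefix.simps)
  next
    case False
    then show ?thesis using run_time_sort_prefix[of "length xs" d xs] assms by simp
  qed
  then show ?thesis
    by (simp add: sort_labels_def run_time_list_length split_beta algebra_simps)
qed

text \<open>A tick, at most 4 steps for \<open>is_written\<close>, and one access: the bound does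
  not depend on the number of vertices.\<close>

lemma run_time_read_array: "run_time (read_array A v) \<le> 6"
  by (simp add: read_array_def is_written_def)

lemma run_time_write_array: "run_time (write_array A v x) \<le> 9"
  by (simp add: write_array_def is_written_def)

lemma run_time_new_array: "run_time (new_array m x) = 2"
  by (cases m) (simp add: new_array.simps)

lemma run_time_initialise: "run_time (initialise s m) \<le> 24"
proof -
  obtain mR mp mt where m: "m = (mR, mp, mt)" by (cases m)
  show ?thesis
    using run_time_write_array[of "result (new_array mR False)" s True]
      run_time_write_array[of "result (new_array mt \<infinity>)" s 0]
    unfolding m by (simp add: run_time_new_array)
qed

text \<open>A tick, three reads, a comparison and at most three writes: 1 + 3 * 6 + 1 + 3 * 9 =
  47.\<close>

lemma run_time_process: "run_time (process e \<sigma>) \<le> 47"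
proof -
  obtain a b l R p t where [simp]: "e = (a, b, l)" "\<sigma> = (R, p, t)"
    by (cases e; cases \<sigma>)
  show ?thesis
    using run_time_read_array[of R a] run_time_read_array[of R b] run_time_read_array[of t a]
      run_time_write_array[of p b "Some a"] run_time_write_array[of t b "enat l"]
      run_time_write_array[of R b True]
    by simp
qed

lemma run_time_process_all: "run_time (process_all es \<sigma>) \<le> 48 * length es + 1"
proof (induction es arbitrary: \<sigma>)
  case (Cons e es)
  show ?case
    using Cons.IH[of "result (process e \<sigma>)"] run_time_process[of e \<sigma>] by simp
qed simp

lemma run_time_foremost_journey:
  assumes "length xs \<le> 2 ^ d"
  shows "run_time (foremost_journey xs s m) \<le> (3 * d + 56) * length xs + 27"
proof -
  have "length (result (sort_labels xs)) = length xs"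
    using mset_eq_length[OF sort_labels_correct(1)] .
  then show ?thesis
    using run_time_sort_labels[OF assms] run_time_initialise[of s m]
      run_time_process_all[of "result (sort_labels xs)" "result (initialise s m)"]
    by (simp add: foremost_journey_def algebra_simps)
qed

lemma algorithm_time_le:
  assumes "I \<in> inputs" and c: "2 \<le> input_cost I"
  shows "real (algorithm_time I) \<le> 144 * (real (input_cost I) * log 2 (real (input_cost I)))"
proof -
  obtain G xs s m where I: "I = (G, xs, s, m)" by (cases I)
  define c where "c = labeling_cost G"
  \<comment> \<open>\<open>Suc\<close> doubles the power of two, absorbing the factor 2 in the bound
    \<open>2 * c\<close> on the number of time edges.\<close>
  define d where "d = Suc (nat \<lceil>log 2 c\<rceil>)"
  have c: "2 \<le> c" using assms I c_def by simp
  then have L: "1 \<le> log 2 (real c)" by simp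
  have n: "length xs \<le> 2 * c"
    using assms card_time_edges_le[of G] distinct_card[of xs] unfolding I c_def inputs_def by simp
  have "real c = 2 powr log 2 c" using c by simp
  also have "\<dots> \<le> 2 powr real (nat \<lceil>log 2 c\<rceil>)" by (intro powr_mono) linarith+
  also have "\<dots> = real (2 ^ nat \<lceil>log 2 c\<rceil>)" by (simp add: powr_realpow)
  finally have "c \<le> 2 ^ nat \<lceil>log 2 c\<rceil>" by (simp only: of_nat_le_iff)
  then have "length xs \<le> 2 ^ d" using n by (simp add: d_def)
  then have "algorithm_time I \<le> (3 * d + 56) * length xs + 27"
    unfolding I by (simp add: run_time_foremost_journey)
  \<comment> \<open>27 \<le> 14 * c because c \<ge> 2.\<close>
  also have "\<dots> \<le> (3 * d + 56) * (2 * c) + 14 * c"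
    using n c by (intro add_mono mult_left_mono) auto
  also have "\<dots> = (6 * d + 126) * c" by (simp add: algebra_simps)
  finally have "real (algorithm_time I) \<le> real ((6 * d + 126) * c)" by (simp only: of_nat_le_iff)
  also have "\<dots> = (6 * real d + 126) * real c" by simp
  also have "\<dots> \<le> (144 * log 2 c) * real c"
  proof (rule mult_right_mono)
    have "real d \<le> log 2 c + 2" using L unfolding d_def by linarith
    \<comment> \<open>The left side is at most 6 * log 2 c + 138, and log 2 c \<ge> 1 turns the
      constant into a multiple of the logarithm.\<close>
    then show "6 * real d + 126 \<le> 144 * log 2 c" using L by linarith
  qed simp
  finally show ?thesis by (simp add: I c_def mult_ac)
qed

theorem corollary1:
  shows "(\<lambda>I::'v input. real (algorithm_time I))
           \<in> O[large_cost](\<lambda>I. real (input_cost I) * log 2 (real (input_cost I)))"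
\<comment> \<open>The threshold 2 is the least cost whose binary logarithm reaches 1.\<close>
proof (rule bigoI[where c = 144], unfold eventually_large_cost, intro exI[of _ 2] ballI impI)
  fix I :: "'v input"
  assume "I \<in> inputs" "2 \<le> input_cost I"
  from algorithm_time_le[OF this]
  show "norm (real (algorithm_time I))
      \<le> 144 * norm (real (input_cost I) * log 2 (real (input_cost I)))"
    unfolding real_norm_def by linarith
qed

end
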